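(* Let $\Gamma$ be a finite group acting linearly on $\mathbb{R}^n$ and let $d \in \mathbb{N}$. Suppose $M \subseteq \mathbb{R}^n$ is a $\Gamma$-invariant, minimal unisolvent set for $\mathbb{R}[x]_{\le 2d}$. Then any set of representatives $R$ for the $\Gamma$-orbits in $M$ is minimal unisolvent for $\mathbb{R}[x]^\Gamma_{\le 2d}$.
   Context: Here $x=(x_1,\ldots,x_n)$, $\mathbb{R}[x]_{\le 2d}$ is the space of real polynomials of degree at most $2d$, and $\mathbb{R}[x]^\Gamma_{\le 2d}$ is its subspace of $\Gamma$-invariant polynomials, where $\Gamma$ acts by $\gamma p(x) = p(\gamma^{-1}x)$. A set of points $S \subseteq \mathbb{R}^n$ is unisolvent for a space $W$ of polynomials if every polynomial in $W$ that vanishes on $S$ is identically zero; it is minimal unisolvent if moreover no strict subset of $S$ is unisolvent for $W$. A set of representatives for the orbits in $M$ contains exactly one point of each $\Gamma$-orbit contained in $M$. *)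

theory Defs
  imports "HOL-Analysis.Analysis" "HOL-Algebra.Group_Action"
begin

(* Since the reals are infinite, a real polynomial is identified with the function it induces. *)

definition monomial_fun :: "('n::finite \<Rightarrow> nat) \<Rightarrow> real ^ 'n \<Rightarrow> real" where
  "monomial_fun \<alpha> x = (\<Prod>i\<in>UNIV. (x $ i) ^ \<alpha> i)"

lemma finite_exponents_le: "finite {\<alpha> :: 'n::finite \<Rightarrow> nat. (\<Sum>i\<in>UNIV. \<alpha> i) \<le> k}"
proof (rule finite_subset)
  show "{\<alpha> :: 'n \<Rightarrow> nat. (\<Sum>i\<in>UNIV. \<alpha> i) \<le> k} \<subseteq> PiE UNIV (\<lambda>_. {..k})"
  proof
    fix \<alpha> :: "'n \<Rightarrow> nat"
    assume "\<alpha> \<in> {\<alpha>. (\<Sum>i\<in>UNIV. \<alpha> i) \<le> k}"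
    moreover have "\<alpha> i \<le> (\<Sum>i\<in>UNIV. \<alpha> i)" for i
      by (rule member_le_sum) auto
    ultimately show "\<alpha> \<in> PiE UNIV (\<lambda>_. {..k})"
      by (auto intro: order_trans)
  qed
  show "finite (PiE (UNIV :: 'n set) (\<lambda>_. {..k}))"
    by (rule finite_PiE) auto
qed

(* The index set of the sum is finite by finite_exponents_le. *)
definition polys_le :: "nat \<Rightarrow> (real ^ 'n::finite \<Rightarrow> real) set" where
  "polys_le k =
     {p. \<exists>c. p = (\<lambda>x. \<Sum>\<alpha> | (\<Sum>i\<in>UNIV. \<alpha> i) \<le> k. c \<alpha> * monomial_fun \<alpha> x)}"

definition linear_action ::
  "('g, 'b) monoid_scheme \<Rightarrow> ('g \<Rightarrow> real ^ 'n::finite \<Rightarrow> real ^ 'n) \<Rightarrow> bool" where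
  "linear_action G \<phi> \<longleftrightarrow> group_action G UNIV \<phi> \<and> (\<forall>\<gamma>\<in>carrier G. linear (\<phi> \<gamma>))"

definition poly_act ::
  "('g, 'b) monoid_scheme \<Rightarrow> ('g \<Rightarrow> real ^ 'n::finite \<Rightarrow> real ^ 'n) \<Rightarrow>
     'g \<Rightarrow> (real ^ 'n \<Rightarrow> real) \<Rightarrow> (real ^ 'n \<Rightarrow> real)" where
  "poly_act G \<phi> \<gamma> p = (\<lambda>x. p (\<phi> (inv\<^bsub>G\<^esub> \<gamma>) x))"

definition inv_polys_le ::
  "('g, 'b) monoid_scheme \<Rightarrow> ('g \<Rightarrow> real ^ 'n::finite \<Rightarrow> real ^ 'n) \<Rightarrow>
     nat \<Rightarrow> (real ^ 'n \<Rightarrow> real) set" where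
  "inv_polys_le G \<phi> k = {p \<in> polys_le k. \<forall>\<gamma>\<in>carrier G. poly_act G \<phi> \<gamma> p = p}"

definition unisolvent :: "(real ^ 'n::finite \<Rightarrow> real) set \<Rightarrow> (real ^ 'n) set \<Rightarrow> bool" where
  "unisolvent W S \<longleftrightarrow> (\<forall>p\<in>W. (\<forall>x\<in>S. p x = 0) \<longrightarrow> p = (\<lambda>_. 0))"

definition minimal_unisolvent ::
  "(real ^ 'n::finite \<Rightarrow> real) set \<Rightarrow> (real ^ 'n) set \<Rightarrow> bool" where
  "minimal_unisolvent W S \<longleftrightarrow> unisolvent W S \<and> (\<forall>T. T \<subset> S \<longrightarrow> \<not> unisolvent W T)"

definition invariant_set :: "('g, 'b) monoid_scheme \<Rightarrow> ('g \<Rightarrow> 'a \<Rightarrow> 'a) \<Rightarrow> 'a set \<Rightarrow> bool" where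
  "invariant_set G \<phi> M \<longleftrightarrow> (\<forall>\<gamma>\<in>carrier G. \<phi> \<gamma> ` M = M)"

definition orbit_representatives ::
  "('g, 'b) monoid_scheme \<Rightarrow> ('g \<Rightarrow> 'a \<Rightarrow> 'a) \<Rightarrow> 'a set \<Rightarrow> 'a set \<Rightarrow> bool" where
  "orbit_representatives G \<phi> M R \<longleftrightarrow>
     R \<subseteq> M \<and> (\<forall>X\<in>orbits G UNIV \<phi>. X \<subseteq> M \<longrightarrow> (\<exists>!x. x \<in> R \<inter> X))"

end

theory Submission
  imports Defs
begin

text \<open>
  An invariant polynomial that vanishes on \<open>R\<close> vanishes on every orbit in \<open>M\<close>, hence on \<open>M\<close>, so it
  is zero; this gives unisolvence of \<open>R\<close>.

  For minimality, let \<open>T \<subset> R\<close> and choose \<open>r \<in> R - T\<close>. Since \<open>M\<close> is minimal, some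
  \<open>p \<in> polys_le (2 * d)\<close> vanishes on \<open>M - {r}\<close> but not at \<open>r\<close>. Its sum over the group,
  \<open>q x = (\<Sum>g. p (\<phi> g x))\<close>, is invariant. A point of \<open>T\<close> lies in another orbit than \<open>r\<close>, so all
  summands vanish there and \<open>q = 0\<close> on \<open>T\<close>. At \<open>r\<close> only the stabilizer of \<open>r\<close> contributes, each of
  its elements with the value \<open>p r\<close>, so \<open>q r \<noteq> 0\<close> because the stabilizer is finite and contains the
  unit of the group. Hence \<open>T\<close> is not unisolvent for the invariant polynomials.

  That \<open>q\<close> satisfies the same degree bound as \<open>p\<close> rests on the stability of \<open>polys_le k\<close> under
  linear substitutions (lemma \<open>polys_le_compose_linear\<close>), which follows from its closure under
  linear combinations and, with addition of the degree bounds, under products, since each component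
  of a linear map has degree at most one.
\<close>

section \<open>Polynomials of bounded degree and linear substitutions\<close>

lemma polys_leI:
  "p = (\<lambda>x. \<Sum>\<alpha> | (\<Sum>i\<in>UNIV. \<alpha> i) \<le> k. c \<alpha> * monomial_fun \<alpha> x) \<Longrightarrow> p \<in> polys_le k"
  unfolding polys_le_def by blast

lemma polys_leE:
  assumes "p \<in> polys_le k"
  obtains c where "p = (\<lambda>x. \<Sum>\<alpha> | (\<Sum>i\<in>UNIV. \<alpha> i) \<le> k. c \<alpha> * monomial_fun \<alpha> x)"
  using assms unfolding polys_le_def by blast

lemma polys_le_zero: "(\<lambda>_. 0) \<in> polys_le k"
  by (rule polys_leI[where c = "\<lambda>_. 0"]) simp

lemma polys_le_add:
  assumes "p \<in> polys_le k" "q \<in> polys_le k"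
  shows "(\<lambda>x. p x + q x) \<in> polys_le k"
proof -
  obtain c where c: "p = (\<lambda>x. \<Sum>\<alpha> | (\<Sum>i\<in>UNIV. \<alpha> i) \<le> k. c \<alpha> * monomial_fun \<alpha> x)"
    using assms(1) by (rule polys_leE)
  obtain e where e: "q = (\<lambda>x. \<Sum>\<alpha> | (\<Sum>i\<in>UNIV. \<alpha> i) \<le> k. e \<alpha> * monomial_fun \<alpha> x)"
    using assms(2) by (rule polys_leE)
  show ?thesis
    by (rule polys_leI[where c = "\<lambda>\<alpha>. c \<alpha> + e \<alpha>"]) (simp add: c e sum.distrib distrib_right)
qed

lemma polys_le_cmult:
  assumes "p \<in> polys_le k"
  shows "(\<lambda>x. a * p x) \<in> polys_le k"
proof -
  obtain c where c: "p = (\<lambda>x. \<Sum>\<alpha> | (\<Sum>i\<in>UNIV. \<alpha> i) \<le> k. c \<alpha> * monomial_fun \<alpha> x)"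
    using assms by (rule polys_leE)
  show ?thesis
    by (rule polys_leI[where c = "\<lambda>\<alpha>. a * c \<alpha>"]) (simp add: c sum_distrib_left mult.assoc)
qed

text \<open>No finiteness of \<open>I\<close> is needed: a sum over an infinite set is 0 by convention.\<close>

lemma polys_le_sum:
  assumes "\<And>i. i \<in> I \<Longrightarrow> f i \<in> polys_le k"
  shows "(\<lambda>x. \<Sum>i\<in>I. f i x) \<in> polys_le k"
  using assms
proof (induction I rule: infinite_finite_induct)
  case (insert i I)
  then show ?case by (simp add: polys_le_add)
qed (simp_all add: polys_le_zero)

lemma monomial_fun_in_polys_le:
  assumes "(\<Sum>i\<in>UNIV. \<alpha> i) \<le> k"
  shows "monomial_fun \<alpha> \<in> polys_le k"
proof (rule polys_leI[where c = "\<lambda>\<beta>. if \<beta> = \<alpha> then 1 else 0"], rule ext)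
  fix x
  have "(\<Sum>\<beta> | (\<Sum>i\<in>UNIV. \<beta> i) \<le> k. (if \<beta> = \<alpha> then 1 else 0) * monomial_fun \<beta> x)
      = (\<Sum>\<beta> | (\<Sum>i\<in>UNIV. \<beta> i) \<le> k. if \<beta> = \<alpha> then monomial_fun \<beta> x else 0)"
    by (rule sum.cong) auto
  then show "monomial_fun \<alpha> x
      = (\<Sum>\<beta> | (\<Sum>i\<in>UNIV. \<beta> i) \<le> k. (if \<beta> = \<alpha> then 1 else 0) * monomial_fun \<beta> x)"
    using assms by (simp add: finite_exponents_le)
qed

lemma monomial_fun_mult:
  "monomial_fun \<alpha> x * monomial_fun \<beta> x = monomial_fun (\<lambda>i. \<alpha> i + \<beta> i) x"
  by (simp add: monomial_fun_def power_add prod.distrib)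

lemma polys_le_mult:
  assumes "p \<in> polys_le j" "q \<in> polys_le k"
  shows "(\<lambda>x. p x * q x) \<in> polys_le (j + k)"
proof -
  obtain c where c: "p = (\<lambda>x. \<Sum>\<alpha> | (\<Sum>i\<in>UNIV. \<alpha> i) \<le> j. c \<alpha> * monomial_fun \<alpha> x)"
    using assms(1) by (rule polys_leE)
  obtain e where e: "q = (\<lambda>x. \<Sum>\<beta> | (\<Sum>i\<in>UNIV. \<beta> i) \<le> k. e \<beta> * monomial_fun \<beta> x)"
    using assms(2) by (rule polys_leE)
  have "(\<lambda>x. p x * q x) = (\<lambda>x. \<Sum>\<alpha> | (\<Sum>i\<in>UNIV. \<alpha> i) \<le> j. \<Sum>\<beta> | (\<Sum>i\<in>UNIV. \<beta> i) \<le> k.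
      (c \<alpha> * e \<beta>) * monomial_fun (\<lambda>i. \<alpha> i + \<beta> i) x)"
    unfolding c e sum_product monomial_fun_mult[symmetric] by (simp only: mult_ac)
  also have "\<dots> \<in> polys_le (j + k)"
    by (intro polys_le_sum polys_le_cmult monomial_fun_in_polys_le)
      (simp add: sum.distrib add_mono)
  finally show ?thesis .
qed

lemma polys_le_one: "(\<lambda>_. 1) \<in> polys_le 0"
  using monomial_fun_in_polys_le[of "\<lambda>_. 0" 0] by (simp add: monomial_fun_def[abs_def])

lemma polys_le_power:
  assumes "p \<in> polys_le k"
  shows "(\<lambda>x. p x ^ m) \<in> polys_le (m * k)"
proof (induction m)
  case 0
  then show ?case by (simp add: polys_le_one)
next
  case (Suc m)
  then show ?case using polys_le_mult[OF assms Suc] by simp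
qed

lemma polys_le_prod:
  assumes "finite I" "\<And>i. i \<in> I \<Longrightarrow> f i \<in> polys_le (k i)"
  shows "(\<lambda>x. \<Prod>i\<in>I. f i x) \<in> polys_le (\<Sum>i\<in>I. k i)"
  using assms
proof (induction I rule: finite_induct)
  case empty
  then show ?case by (simp add: polys_le_one)
next
  case (insert i I)
  then show ?case by (simp add: polys_le_mult)
qed

lemma polys_le_mono:
  assumes "j \<le> k"
  shows "polys_le j \<subseteq> polys_le k"
proof
  fix p :: "real ^ 'n \<Rightarrow> real"
  assume "p \<in> polys_le j"
  then obtain c where c: "p = (\<lambda>x. \<Sum>\<alpha> | (\<Sum>i\<in>UNIV. \<alpha> i) \<le> j. c \<alpha> * monomial_fun \<alpha> x)"
    by (rule polys_leE)
  show "p \<in> polys_le k"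
    unfolding c using assms
    by (intro polys_le_sum polys_le_cmult monomial_fun_in_polys_le) auto
qed

lemma component_in_polys_le: "(\<lambda>x :: real ^ 'n::finite. x $ i) \<in> polys_le 1"
proof -
  have "(\<Prod>j\<in>UNIV. (x $ j) ^ (if j = i then 1 else 0)) = x $ i" for x :: "real ^ 'n"
  proof -
    have "(\<Prod>j\<in>UNIV. (x $ j) ^ (if j = i then 1 else 0))
        = (\<Prod>j\<in>UNIV. if j = i then x $ j else 1)"
      by (rule prod.cong) auto
    then show ?thesis by simp
  qed
  then have "(\<lambda>x. x $ i) = monomial_fun (\<lambda>j. if j = i then 1 else 0)"
    by (simp add: monomial_fun_def[abs_def])
  then show ?thesis by (simp add: monomial_fun_in_polys_le)
qed

lemma linear_component_in_polys_le:
  fixes f :: "real ^ 'n::finite \<Rightarrow> real ^ 'm::finite"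
  assumes "linear f"
  shows "(\<lambda>x. f x $ i) \<in> polys_le 1"
proof -
  have "f x $ i = (\<Sum>j\<in>UNIV. matrix f $ i $ j * x $ j)" for x
  proof -
    have "f x = matrix f *v x"
      using assms by simp
    then show ?thesis
      by (simp add: matrix_vector_mult_def)
  qed
  then show ?thesis
    by (simp only: polys_le_sum polys_le_cmult component_in_polys_le)
qed

lemma polys_le_compose_linear:
  assumes "linear f" "p \<in> polys_le k"
  shows "(\<lambda>x. p (f x)) \<in> polys_le k"
proof -
  obtain c where c: "p = (\<lambda>x. \<Sum>\<alpha> | (\<Sum>i\<in>UNIV. \<alpha> i) \<le> k. c \<alpha> * monomial_fun \<alpha> x)"
    using assms(2) by (rule polys_leE)
  have "(\<lambda>x. monomial_fun \<alpha> (f x)) \<in> polys_le k" if "(\<Sum>i\<in>UNIV. \<alpha> i) \<le> k" for \<alpha>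
  proof -
    have "(\<lambda>x. (f x $ i) ^ \<alpha> i) \<in> polys_le (\<alpha> i)" for i
      using polys_le_power[OF linear_component_in_polys_le[OF assms(1)], of i "\<alpha> i"] by simp
    then have "(\<lambda>x. monomial_fun \<alpha> (f x)) \<in> polys_le (\<Sum>i\<in>UNIV. \<alpha> i)"
      unfolding monomial_fun_def by (intro polys_le_prod) auto
    then show ?thesis using polys_le_mono[OF that] by blast
  qed
  then show ?thesis
    unfolding c by (intro polys_le_sum polys_le_cmult) auto
qed

section \<open>Orbit sums and orbit representatives\<close>

lemma orbit_sum_in_inv_polys_le:
  assumes act: "linear_action G \<phi>" and p: "p \<in> polys_le k"
  shows "(\<lambda>x. \<Sum>g\<in>carrier G. p (\<phi> g x)) \<in> inv_polys_le G \<phi> k" (is "?q \<in> _")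
proof -
  interpret group_action G UNIV \<phi>
    using act by (simp add: linear_action_def)
  interpret G: group G
    using group_hom by (rule group_hom.axioms(1))
  have "?q \<in> polys_le k"
  proof (rule polys_le_sum)
    fix g
    assume "g \<in> carrier G"
    with act have "linear (\<phi> g)"
      by (simp add: linear_action_def)
    then show "(\<lambda>x. p (\<phi> g x)) \<in> polys_le k"
      using p by (rule polys_le_compose_linear)
  qed
  moreover have "poly_act G \<phi> \<gamma> ?q = ?q" if \<gamma>: "\<gamma> \<in> carrier G" for \<gamma>
  proof
    fix x
    have "poly_act G \<phi> \<gamma> ?q x = (\<Sum>g\<in>carrier G. p (\<phi> (g \<otimes>\<^bsub>G\<^esub> inv\<^bsub>G\<^esub> \<gamma>) x))"
      unfolding poly_act_def using \<gamma> by (intro sum.cong) (simp_all add: composition_rule)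
    \<comment> \<open>Right translation by \<open>inv \<gamma>\<close> permutes the group.\<close>
    also have "\<dots> = ?q x"
      using \<gamma> by (intro sum.reindex_bij_witness
          [where i = "\<lambda>g. g \<otimes>\<^bsub>G\<^esub> \<gamma>" and j = "\<lambda>g. g \<otimes>\<^bsub>G\<^esub> inv\<^bsub>G\<^esub> \<gamma>"])
        (simp_all add: G.m_assoc)
    finally show "poly_act G \<phi> \<gamma> ?q x = ?q x" .
  qed
  ultimately show ?thesis by (simp add: inv_polys_le_def)
qed

theorem lemma4p3:
  fixes G :: "('g, 'b) monoid_scheme"
    and \<phi> :: "'g \<Rightarrow> real ^ 'n::finite \<Rightarrow> real ^ 'n"
    and d :: nat
    and M R :: "(real ^ 'n) set"
  assumes "finite (carrier G)"
    and "linear_action G \<phi>"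
    and "invariant_set G \<phi> M"
    and "minimal_unisolvent (polys_le (2 * d)) M"
    and "orbit_representatives G \<phi> M R"
  shows "minimal_unisolvent (inv_polys_le G \<phi> (2 * d)) R"
proof -
  interpret group_action G UNIV \<phi>
    using assms(2) by (simp add: linear_action_def)
  interpret G: group G
    using group_hom by (rule group_hom.axioms(1))
  have M_closed: "\<phi> g x \<in> M" if "g \<in> carrier G" "x \<in> M" for g x
    using assms(3) that by (auto simp: invariant_set_def)
  have RM: "R \<subseteq> M"
    using assms(5) by (simp add: orbit_representatives_def)
  have rep: "\<exists>!y. y \<in> R \<inter> orbit G \<phi> x" if "x \<in> M" for x
  proof -
    have "orbit G \<phi> x \<in> orbits G UNIV \<phi>"
      by (auto simp: orbits_def)
    moreover have "orbit G \<phi> x \<subseteq> M"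
      using that M_closed by (auto simp: orbit_def)
    ultimately show ?thesis
      using assms(5) unfolding orbit_representatives_def by blast
  qed
  show ?thesis
    unfolding minimal_unisolvent_def
  proof (intro conjI allI impI)
    show "unisolvent (inv_polys_le G \<phi> (2 * d)) R"
      unfolding unisolvent_def
    proof (intro ballI impI)
      fix p
      assume p: "p \<in> inv_polys_le G \<phi> (2 * d)" and zero: "\<forall>x\<in>R. p x = 0"
      have "p x = 0" if x: "x \<in> M" for x
      proof -
        obtain g where g: "g \<in> carrier G" "\<phi> g x \<in> R"
          using rep[OF x] by (auto simp: orbit_def)
        have "poly_act G \<phi> (inv\<^bsub>G\<^esub> g) p = p"
          using p g(1) by (simp add: inv_polys_le_def)
        then have "p x = p (\<phi> g x)"
          using g(1) by (metis G.inv_inv poly_act_def)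
        with g(2) zero show ?thesis by simp
      qed
      with p assms(4) show "p = (\<lambda>_. 0)"
        by (auto simp: inv_polys_le_def minimal_unisolvent_def unisolvent_def)
    qed
  next
    fix T
    assume "T \<subset> R"
    then obtain r where r: "r \<in> R" "r \<notin> T" and TR: "T \<subseteq> R"
      by blast
    have "M - {r} \<subset> M"
      using r(1) RM by blast
    then have "\<not> unisolvent (polys_le (2 * d)) (M - {r})"
      using assms(4) unfolding minimal_unisolvent_def by blast
    then obtain p where p: "p \<in> polys_le (2 * d)" "p \<noteq> (\<lambda>_. 0)"
      and pM: "\<And>x. x \<in> M \<Longrightarrow> x \<noteq> r \<Longrightarrow> p x = 0"
      unfolding unisolvent_def by blast
    have pr: "p r \<noteq> 0"
    proof
      assume "p r = 0"
      then have "\<forall>x\<in>M. p x = 0"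
        using pM by metis
      with p assms(4) show False
        unfolding minimal_unisolvent_def unisolvent_def by blast
    qed
    define q where "q = (\<lambda>x. \<Sum>g\<in>carrier G. p (\<phi> g x))"
    have q_inv: "q \<in> inv_polys_le G \<phi> (2 * d)"
      unfolding q_def using assms(2) p(1) by (rule orbit_sum_in_inv_polys_le)
    have qT: "q x = 0" if x: "x \<in> T" for x
      unfolding q_def
    proof (rule sum.neutral, rule ballI)
      fix g
      assume g: "g \<in> carrier G"
      have xM: "x \<in> M"
        using x TR RM by blast
      have "\<phi> g x \<noteq> r"
      proof
        assume "\<phi> g x = r"
        then have "r \<in> R \<inter> orbit G \<phi> x"
          using g r(1) by (auto simp: orbit_def)
        moreover have "x \<in> R \<inter> orbit G \<phi> x"
          using x TR orbit_refl[of x] by auto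
        ultimately have "x = r"
          using rep[OF xM] by blast
        with x r(2) show False by simp
      qed
      with pM M_closed[OF g xM] show "p (\<phi> g x) = 0" by blast
    qed
    have "q r \<noteq> 0"
    proof -
      have "q r = (\<Sum>g\<in>stabilizer G \<phi> r. p (\<phi> g r))"
        unfolding q_def
      proof (rule sum.mono_neutral_right)
        show "\<forall>g\<in>carrier G - stabilizer G \<phi> r. p (\<phi> g r) = 0"
          using pM M_closed r(1) RM unfolding stabilizer_def by blast
      qed (use assms(1) stabilizer_subset in auto)
      also have "\<dots> = real (card (stabilizer G \<phi> r)) * p r"
        by (simp add: stabilizer_def)
      finally have "q r = real (card (stabilizer G \<phi> r)) * p r" .
      moreover have "\<one>\<^bsub>G\<^esub> \<in> stabilizer G \<phi> r"
        by (simp add: stabilizer_one_closed)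
      moreover have "finite (stabilizer G \<phi> r)"
        using assms(1) by (simp add: stabilizer_def)
      ultimately show ?thesis
        using pr by (auto simp: card_eq_0_iff)
    qed
    then show "\<not> unisolvent (inv_polys_le G \<phi> (2 * d)) T"
      using q_inv qT unfolding unisolvent_def by metis
  qed
qed

end
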